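(* Let $F\in\mathbb{Z}[X_1,\ldots,X_n]^n$ be a polynomial automorphism of the form $F_i=X_i+H_i$, $i=1,\ldots,n$, where $H_i$ has degree $D_i$ and lower degree $d_i\ge2$, with inverse $G\in\mathbb{Z}[X]^n$; put $d=\min_i d_i$ and $D=\max_i D_i$. Let $B$ be the maximum of the absolute values of the coefficients of monomials appearing in $F$, and $A$ the maximum of the absolute values of the coefficients of monomials appearing in $G$. Then \[ A\le B^{\sum_{i=0}^{\mu-2}D^i}\cdot(l(F)-1)^{\mu-2}\prod_{j=1}^{\mu-2}\Big(l(F)^{D^j}+1\Big)^{\mu-1-j}\cdot\Big[l(F)+(l(F)-1)\sum_{r=2}^{\mu-1}\prod_{s=1}^{r-1}\big(l(F)^{D^s}+1\big)\Big],\] where $\mu:=\big\lfloor\frac{D^{n-1}-d}{d-1}+1\big\rfloor+1$.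
   Context: The lower degree of a polynomial is the minimal total degree of a monomial appearing in it with nonzero coefficient. For a polynomial $T$, its length $l(T)$ is the number of monomials appearing in $T$ (with nonzero coefficient); for a polynomial map $T=(T_1,\ldots,T_n)$, $l(T)=\max\{l(T_1),\ldots,l(T_n)\}$. *)

theory Defs
  imports Complex_Main "HOL-Library.Poly_Mapping" "HOL-Library.Cardinality"
begin

text \<open>
  The polynomial ring over \<open>'a\<close> in variables indexed by the finite type \<open>'n\<close>, so that the
  number of variables is \<open>CARD('n)\<close>. Exponent vectors are finitely supported maps to \<open>nat\<close>,
  polynomials are finitely supported maps from exponent vectors to coefficients, and the ring
  structure is the convolution product of \<open>HOL-Library.Poly_Mapping\<close>.
  The monomials appearing in a polynomial are its \<open>keys\<close>.
\<close>

type_synonym ('n, 'a) mpoly = "('n \<Rightarrow>\<^sub>0 nat) \<Rightarrow>\<^sub>0 'a"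

type_synonym ('n, 'a) pmap = "'n \<Rightarrow> ('n, 'a) mpoly"

definition mconst :: "'a::zero \<Rightarrow> ('n, 'a) mpoly" where
  "mconst c = Poly_Mapping.single 0 c"

definition mvar :: "'n \<Rightarrow> ('n, 'a::zero_neq_one) mpoly" where
  "mvar i = Poly_Mapping.single (Poly_Mapping.single i 1) 1"

definition msubst :: "('n::finite, 'a::comm_semiring_1) mpoly \<Rightarrow> ('n, 'a) pmap \<Rightarrow> ('n, 'a) mpoly" where
  "msubst p F =
    (\<Sum>m \<in> Poly_Mapping.keys p.
       mconst (Poly_Mapping.lookup p m) * (\<Prod>i\<in>UNIV. F i ^ Poly_Mapping.lookup m i))"

definition pmap_comp :: "('n::finite, 'a::comm_semiring_1) pmap \<Rightarrow> ('n, 'a) pmap \<Rightarrow> ('n, 'a) pmap" where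
  "pmap_comp F G = (\<lambda>i. msubst (F i) G)"

text \<open>The identity map is \<open>mvar\<close>.\<close>

definition pmap_inverse :: "('n::finite, 'a::comm_semiring_1) pmap \<Rightarrow> ('n, 'a) pmap \<Rightarrow> bool" where
  "pmap_inverse F G \<longleftrightarrow> pmap_comp F G = mvar \<and> pmap_comp G F = mvar"

definition polynomial_automorphism :: "('n::finite, 'a::comm_semiring_1) pmap \<Rightarrow> bool" where
  "polynomial_automorphism F \<longleftrightarrow> (\<exists>G. pmap_inverse F G)"

definition monom_deg :: "('n::finite \<Rightarrow>\<^sub>0 nat) \<Rightarrow> nat" where
  "monom_deg m = (\<Sum>i\<in>UNIV. Poly_Mapping.lookup m i)"

text \<open>Both degrees are meaningful only for nonzero polynomials.\<close>

definition mdegree :: "('n::finite, 'a::zero) mpoly \<Rightarrow> nat" where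
  "mdegree p = Max (monom_deg ` Poly_Mapping.keys p)"

definition lower_degree :: "('n::finite, 'a::zero) mpoly \<Rightarrow> nat" where
  "lower_degree p = Min (monom_deg ` Poly_Mapping.keys p)"

definition mlength :: "('n, 'a::zero) mpoly \<Rightarrow> nat" where
  "mlength p = card (Poly_Mapping.keys p)"

definition pmap_length :: "('n::finite, 'a::zero) pmap \<Rightarrow> nat" where
  "pmap_length F = Max (range (\<lambda>i. mlength (F i)))"

definition max_abs_coeff :: "('n::finite, int) pmap \<Rightarrow> int" where
  "max_abs_coeff F =
    Max (\<Union>i. (\<lambda>m. \<bar>Poly_Mapping.lookup (F i) m\<bar>) ` Poly_Mapping.keys (F i))"

end

theory Submission
  imports Defs "HOL-Library.FuncSet"
begin

text \<open>
  Let \<open>\<phi>\<close> be substitution of \<open>F\<close> and \<open>\<delta> = \<phi> - 1\<close>. Since \<open>\<delta>\<close> raises the order by at least \<open>d - 1\<close>,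
  the geometric series \<open>\<Sum>\<^sub>r (-1)\<^sup>r \<delta>\<^sup>r X\<^sub>i\<close>, cut off after \<open>\<mu>\<close> terms, agrees with \<open>G\<^sub>i = \<phi>\<^sup>-\<^sup>1 X\<^sub>i\<close> in all
  degrees up to \<open>\<mu> (d - 1) \<ge> D\<^sup>n\<^sup>-\<^sup>1\<close>. The sum of the absolute values of the coefficients grows under
  \<open>\<delta>\<close> at most by the factor \<open>(l B)\<^sup>k + 1\<close> on polynomials of degree at most \<open>k\<close>, which bounds the
  coefficients of the series; the remaining factors of the claimed bound are at least 1.

  It remains to see that \<open>G\<^sub>i\<close> has degree \<open>e \<le> D\<^sup>n\<^sup>-\<^sup>1\<close>, which is Gabber's bound. If \<open>u\<close> is a leading
  monomial of \<open>G\<^sub>i\<close>, then the polynomials \<open>X\<^sub>i\<^sup>a F\<^sup>b\<close> with \<open>b\<close> not divisible by \<open>u\<close> and \<open>a + D |b| \<le> D M\<close> are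
  linearly independent and of degree at most \<open>D M\<close>. Writing \<open>s(M)\<close> for the number of monomials of
  degree at most \<open>M\<close>, this gives \<open>D e s(M - e) \<le> s(D M) \<le> D\<^sup>n s(M)\<close>, and since \<open>s\<close> grows only
  polynomially, \<open>D e \<le> D\<^sup>n\<close>.
\<close>

abbreviation keys :: "('b \<Rightarrow>\<^sub>0 'c::zero) \<Rightarrow> 'b set" where
  "keys \<equiv> Poly_Mapping.keys"

abbreviation lookup :: "('b \<Rightarrow>\<^sub>0 'c::zero) \<Rightarrow> 'b \<Rightarrow> 'c" where
  "lookup \<equiv> Poly_Mapping.lookup"

abbreviation single :: "'b \<Rightarrow> 'c \<Rightarrow> 'b \<Rightarrow>\<^sub>0 'c::zero" where
  "single \<equiv> Poly_Mapping.single"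

section \<open>Substitution is a ring homomorphism\<close>

lemma poly_mapping_sum_single:
  fixes p :: "'b \<Rightarrow>\<^sub>0 'c::comm_monoid_add"
  shows "p = (\<Sum>m\<in>keys p. single m (lookup p m))"
proof (rule poly_mapping_eqI)
  fix k
  have "lookup (\<Sum>m\<in>keys p. single m (lookup p m)) k
      = (\<Sum>m\<in>keys p. if m = k then lookup p m else 0)"
    unfolding lookup_sum by (rule sum.cong) (auto simp: lookup_single when_def)
  also have "\<dots> = lookup p k"
    by (auto simp: in_keys_iff)
  finally show "lookup p k = lookup (\<Sum>m\<in>keys p. single m (lookup p m)) k" ..
qed

definition monom_subst :: "('n::finite \<Rightarrow>\<^sub>0 nat) \<Rightarrow> ('n, 'a::comm_semiring_1) pmap \<Rightarrow> ('n, 'a) mpoly" where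
  "monom_subst m F = (\<Prod>i\<in>UNIV. F i ^ lookup m i)"

lemma monom_subst_zero [simp]: "monom_subst 0 F = 1"
  by (simp add: monom_subst_def)

lemma monom_subst_add: "monom_subst (a + b) F = monom_subst a F * monom_subst b F"
  by (simp add: monom_subst_def lookup_add power_add prod.distrib)

lemma monom_subst_single: "monom_subst (single i k) F = F i ^ k"
proof -
  have "monom_subst (single i k) F = (\<Prod>j\<in>UNIV. if j = i then F i ^ k else 1)"
    unfolding monom_subst_def by (rule prod.cong) (auto simp: lookup_single when_def)
  then show ?thesis by simp
qed

lemma monom_subst_mvar:
  fixes m :: "'n::finite \<Rightarrow>\<^sub>0 nat"
  shows "monom_subst m mvar = single m (1::'a::comm_semiring_1)"
proof -
  have pow: "(mvar i :: ('n, 'a) mpoly) ^ k = single (single i k) 1" for i :: 'n and k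
    by (induction k) (simp_all add: mvar_def mult_single single_add [symmetric])
  have "(\<Prod>i\<in>S. single (single i (lookup m i)) (1::'a))
      = single (\<Sum>i\<in>S. single i (lookup m i)) 1" if "finite S" for S :: "'n set"
    using that by induction (simp_all add: mult_single)
  moreover have "(\<Sum>i\<in>UNIV. single i (lookup m i)) = m"
  proof -
    have "(\<Sum>i\<in>UNIV. single i (lookup m i)) = (\<Sum>i\<in>keys m. single i (lookup m i))"
      by (rule sum.mono_neutral_right) (auto simp: in_keys_iff)
    then show ?thesis using poly_mapping_sum_single [of m] by simp
  qed
  ultimately show ?thesis
    by (simp add: monom_subst_def pow)
qed

lemma mconst_add: "mconst (a + b) = mconst a + mconst b"
  by (simp add: mconst_def single_add)

lemma mconst_mult: "mconst (a * b) = (mconst a * mconst b :: ('n, 'a::comm_semiring_1) mpoly)"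
  by (simp add: mconst_def mult_single)

lemma mconst_zero [simp]: "mconst 0 = 0"
  by (simp add: mconst_def)

lemma mconst_one [simp]: "mconst 1 = (1 :: ('n, 'a::comm_semiring_1) mpoly)"
  by (simp add: mconst_def)

lemma mconst_mult_single: "mconst a * single m b = single m (a * b :: 'a::comm_semiring_1)"
  by (simp add: mconst_def mult_single)

lemma msubst_altdef: "msubst p F = (\<Sum>m\<in>keys p. mconst (lookup p m) * monom_subst m F)"
  by (simp add: msubst_def monom_subst_def)

text \<open>Exponents outside the support contribute zero, so the range of summation may be
  enlarged; several polynomials can then be substituted over one common index set.\<close>

lemma msubst_superset:
  assumes "finite S" "keys p \<subseteq> S"
  shows "msubst p F = (\<Sum>m\<in>S. mconst (lookup p m) * monom_subst m F)"
  unfolding msubst_altdef using assms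
  by (intro sum.mono_neutral_left) (auto simp: in_keys_iff)

lemma msubst_zero [simp]: "msubst 0 F = 0"
  by (simp add: msubst_altdef)

lemma msubst_single: "msubst (single m a) F = mconst a * monom_subst m F"
  by (subst msubst_superset [of "{m}"]) auto

lemma msubst_one [simp]: "msubst 1 F = 1"
  using msubst_single [of 0 1 F] by simp

lemma msubst_mvar [simp]: "msubst (mvar i) F = F i"
  by (simp add: mvar_def msubst_single monom_subst_single)

lemma msubst_add: "msubst (p + q) F = msubst p F + msubst q F"
proof -
  have "keys (p + q) \<subseteq> keys p \<union> keys q" by (rule Poly_Mapping.keys_add)
  then show ?thesis
    by (simp add: msubst_superset [of "keys p \<union> keys q"] lookup_add mconst_add
        distrib_right sum.distrib)
qed

lemma msubst_sum: "msubst (\<Sum>i\<in>S. p i) F = (\<Sum>i\<in>S. msubst (p i) F)"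
  by (induction S rule: infinite_finite_induct) (simp_all add: msubst_add)

text \<open>Both factors are expanded into monomials, for which multiplicativity is
  \<open>monom_subst_add\<close>.\<close>

lemma msubst_mult: "msubst (p * q) F = msubst p F * msubst q F"
proof -
  have "p * q = (\<Sum>a\<in>keys p. \<Sum>b\<in>keys q. single (a + b) (lookup p a * lookup q b))"
    by (subst poly_mapping_sum_single [of p], subst poly_mapping_sum_single [of q])
      (simp add: sum_product mult_single)
  then have "msubst (p * q) F = (\<Sum>a\<in>keys p. \<Sum>b\<in>keys q.
      (mconst (lookup p a) * monom_subst a F) * (mconst (lookup q b) * monom_subst b F))"
    by (simp add: msubst_sum msubst_single mconst_mult monom_subst_add mult_ac)
  then show ?thesis
    by (simp add: sum_product msubst_altdef)
qed

lemma msubst_power: "msubst (p ^ k) F = msubst p F ^ k"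
  by (induction k) (simp_all add: msubst_mult)

lemma msubst_prod: "msubst (\<Prod>i\<in>S. p i) F = (\<Prod>i\<in>S. msubst (p i) F)"
  by (induction S rule: infinite_finite_induct) (simp_all add: msubst_mult)

lemma msubst_mconst [simp]: "msubst (mconst a) F = mconst a"
  using msubst_single [of 0 a F] by (simp add: mconst_def)

lemma msubst_uminus:
  fixes p :: "('n::finite, 'a::comm_ring_1) mpoly"
  shows "msubst (- p) F = - msubst p F"
  using msubst_add [of p "- p" F] by (simp add: eq_neg_iff_add_eq_0 add.commute)

lemma msubst_diff:
  fixes p :: "('n::finite, 'a::comm_ring_1) mpoly"
  shows "msubst (p - q) F = msubst p F - msubst q F"
  using msubst_add [of p "- q" F] by (simp add: msubst_uminus)

lemma msubst_ident [simp]: "msubst p mvar = p"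
  using poly_mapping_sum_single [of p]
  by (simp add: msubst_altdef monom_subst_mvar mconst_mult_single)

lemma msubst_msubst: "msubst (msubst p F) G = msubst p (pmap_comp F G)"
  by (simp add: msubst_altdef [of p] msubst_sum msubst_mult monom_subst_def msubst_prod
      msubst_power pmap_comp_def)

lemma msubst_inverse: "pmap_comp F G = mvar \<Longrightarrow> msubst (msubst p F) G = p"
  by (simp add: msubst_msubst)

section \<open>Degree and order\<close>

text \<open>A predicate instead of a number: the zero polynomial satisfies every bound, whereas its
  \<open>mdegree\<close> and \<open>lower_degree\<close> are not meaningful.\<close>

definition weight_le :: "(('n \<Rightarrow>\<^sub>0 nat) \<Rightarrow> nat) \<Rightarrow> nat \<Rightarrow> ('n, 'a::zero) mpoly \<Rightarrow> bool" where
  "weight_le w k p \<longleftrightarrow> (\<forall>m\<in>keys p. w m \<le> k)"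

definition weight_ge :: "(('n \<Rightarrow>\<^sub>0 nat) \<Rightarrow> nat) \<Rightarrow> nat \<Rightarrow> ('n, 'a::zero) mpoly \<Rightarrow> bool" where
  "weight_ge w k p \<longleftrightarrow> (\<forall>m\<in>keys p. k \<le> w m)"

text \<open>A homomorphism from exponent vectors to the additive naturals. The total degree and the
  functionals that single out a leading monomial are both of this kind.\<close>

definition additive_weight :: "(('n \<Rightarrow>\<^sub>0 nat) \<Rightarrow> nat) \<Rightarrow> bool" where
  "additive_weight w \<longleftrightarrow> w 0 = 0 \<and> (\<forall>a b. w (a + b) = w a + w b)"

lemma additive_weightD:
  assumes "additive_weight w"
  shows "w 0 = 0" "w (a + b) = w a + w b"
  using assms by (auto simp: additive_weight_def)

lemma weight_le_mono: "weight_le w k p \<Longrightarrow> k \<le> k' \<Longrightarrow> weight_le w k' p"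
  by (auto simp: weight_le_def intro: order_trans)

lemma weight_ge_antimono: "weight_ge w k p \<Longrightarrow> k' \<le> k \<Longrightarrow> weight_ge w k' p"
  by (auto simp: weight_ge_def intro: order_trans)

lemma weight_le_add: "weight_le w k p \<Longrightarrow> weight_le w k q \<Longrightarrow> weight_le w k (p + q)"
  using Poly_Mapping.keys_add [of p q] by (auto simp: weight_le_def)

lemma weight_ge_add: "weight_ge w k p \<Longrightarrow> weight_ge w k q \<Longrightarrow> weight_ge w k (p + q)"
  using Poly_Mapping.keys_add [of p q] by (auto simp: weight_ge_def)

lemma weight_le_diff:
  fixes p q :: "('n, 'a::ab_group_add) mpoly"
  shows "weight_le w k p \<Longrightarrow> weight_le w k q \<Longrightarrow> weight_le w k (p - q)"
  using weight_le_add [of w k p "- q"] by (auto simp: weight_le_def)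

lemma weight_le_zero [simp]: "weight_le w k 0"
  by (simp add: weight_le_def)

lemma weight_ge_zero [simp]: "weight_ge w k 0"
  by (simp add: weight_ge_def)

lemma weight_le_sum: "(\<And>i. i \<in> S \<Longrightarrow> weight_le w k (p i)) \<Longrightarrow> weight_le w k (\<Sum>i\<in>S. p i)"
  by (induction S rule: infinite_finite_induct) (simp_all add: weight_le_add)

lemma weight_ge_sum: "(\<And>i. i \<in> S \<Longrightarrow> weight_ge w k (p i)) \<Longrightarrow> weight_ge w k (\<Sum>i\<in>S. p i)"
  by (induction S rule: infinite_finite_induct) (simp_all add: weight_ge_add)

lemma weight_le_mult:
  fixes p q :: "('n, 'a::semiring_0) mpoly"
  assumes w: "additive_weight w" and "weight_le w a p" "weight_le w b q"
  shows "weight_le w (a + b) (p * q)"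
  using assms Poly_Mapping.keys_mult [of p q]
  by (fastforce simp: weight_le_def additive_weight_def intro: add_mono)

lemma weight_ge_mult:
  fixes p q :: "('n, 'a::semiring_0) mpoly"
  assumes w: "additive_weight w" and "weight_ge w a p" "weight_ge w b q"
  shows "weight_ge w (a + b) (p * q)"
  using assms Poly_Mapping.keys_mult [of p q]
  by (fastforce simp: weight_ge_def additive_weight_def intro: add_mono)

lemma weight_le_mconst: "additive_weight w \<Longrightarrow> weight_le w 0 (mconst a)"
  by (simp add: weight_le_def mconst_def additive_weight_def)

lemma weight_ge_0: "weight_ge w 0 p"
  by (simp add: weight_ge_def)

lemma weight_le_power:
  fixes p :: "('n, 'a::comm_semiring_1) mpoly"
  assumes w: "additive_weight w" and p: "weight_le w a p"
  shows "weight_le w (k * a) (p ^ k)"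
proof (induction k)
  case 0
  show ?case using weight_le_mconst [OF w, of "1::'a"] by simp
next
  case (Suc k)
  show ?case using weight_le_mult [OF w p Suc.IH] by simp
qed

lemma weight_le_monom_subst:
  fixes F :: "('n::finite, 'a::comm_semiring_1) pmap"
  assumes w: "additive_weight w" and F: "\<And>i. weight_le w a (F i)"
  shows "weight_le w (a * monom_deg m) (monom_subst m F)"
proof -
  have "weight_le w (\<Sum>i\<in>S. lookup m i * a) (\<Prod>i\<in>S. F i ^ lookup m i)" if "finite S" for S
    using that
  proof induction
    case empty
    show ?case using weight_le_mconst [OF w, of "1::'a"] by simp
  next
    case (insert i S)
    then show ?case
      using weight_le_mult [OF w weight_le_power [OF w F] insert.IH] by simp
  qed
  from this [of UNIV] show ?thesis
    by (simp add: monom_subst_def monom_deg_def sum_distrib_left mult.commute)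
qed

section \<open>Degree and order under substitution\<close>

lemma additive_monom_deg: "additive_weight (monom_deg :: ('n::finite \<Rightarrow>\<^sub>0 nat) \<Rightarrow> nat)"
  by (simp add: additive_weight_def monom_deg_def lookup_add sum.distrib)

lemma monom_deg_single [simp]: "monom_deg (single i k) = k"
proof -
  have "monom_deg (single i k) = (\<Sum>j\<in>UNIV. if j = i then k else 0)"
    unfolding monom_deg_def by (rule sum.cong) (auto simp: lookup_single when_def)
  then show ?thesis by simp
qed

lemma weight_le_msubst:
  fixes F :: "('n::finite, 'a::comm_semiring_1) pmap"
  assumes w: "additive_weight w" and F: "\<And>i. weight_le w a (F i)" and p: "weight_le monom_deg k p"
  shows "weight_le w (a * k) (msubst p F)"
  unfolding msubst_altdef
proof (rule weight_le_sum)
  fix m assume "m \<in> keys p"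
  then have "monom_deg m \<le> k" using p by (simp add: weight_le_def)
  have "weight_le w (0 + a * monom_deg m) (mconst (lookup p m) * monom_subst m F)"
    by (intro weight_le_mult weight_le_mconst weight_le_monom_subst w F)
  then show "weight_le w (a * k) (mconst (lookup p m) * monom_subst m F)"
    using \<open>monom_deg m \<le> k\<close> by (auto elim: weight_le_mono)
qed

text \<open>A congruence between \<open>p\<close> and \<open>q\<close> up to order
  \<open>a + c\<close>, where \<open>q\<close> has order at least \<open>a\<close>. Under products
  the orders \<open>a\<close> add up while the gain \<open>c\<close> persists. For
  \<open>c = 0\<close> and \<open>p = q\<close> it is a plain order bound.\<close>

definition perturb :: "nat \<Rightarrow> nat \<Rightarrow> ('n::finite, 'a::comm_ring_1) mpoly \<Rightarrow> ('n, 'a) mpoly \<Rightarrow> bool" where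
  "perturb c a p q \<longleftrightarrow> weight_ge monom_deg a q \<and> weight_ge monom_deg (a + c) (p - q)"

lemma perturb_one: "perturb c 0 1 1"
  by (simp add: perturb_def weight_ge_0)

lemma perturb_mult:
  assumes "perturb c a p p'" "perturb c b q q'"
  shows "perturb c (a + b) (p * q) (p' * q')"
proof -
  note m = weight_ge_mult [OF additive_monom_deg]
  \<comment> \<open>The order of \<open>q\<close> itself is at least \<open>b\<close>, because this
    holds for \<open>q - q'\<close> and for \<open>q'\<close>.\<close>
  have "weight_ge monom_deg (b + c) (q - q')" "weight_ge monom_deg b q'"
    using assms by (simp_all add: perturb_def)
  then have "weight_ge monom_deg b ((q - q') + q')"
    by (intro weight_ge_add) (auto elim: weight_ge_antimono)
  then have q: "weight_ge monom_deg b q" by simp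
  have "weight_ge monom_deg (a + c + b) ((p - p') * q)"
    using assms q by (intro m) (simp_all add: perturb_def)
  moreover have "weight_ge monom_deg (a + (b + c)) (p' * (q - q'))"
    using assms by (intro m) (simp_all add: perturb_def)
  ultimately have "weight_ge monom_deg (a + b + c) ((p - p') * q + p' * (q - q'))"
    by (intro weight_ge_add) (simp_all add: add_ac)
  moreover have "p * q - p' * q' = (p - p') * q + p' * (q - q')"
    by (simp add: algebra_simps)
  ultimately show ?thesis
    using assms m by (auto simp: perturb_def)
qed

lemma perturb_power: "perturb c a p q \<Longrightarrow> perturb c (k * a) (p ^ k) (q ^ k)"
  by (induction k) (simp_all add: perturb_one perturb_mult)

lemma perturb_monom_subst:
  assumes F: "\<And>i. perturb c a (F i) (F' i)"
  shows "perturb c (a * monom_deg m) (monom_subst m F) (monom_subst m F')"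
proof -
  have "perturb c (\<Sum>i\<in>S. lookup m i * a) (\<Prod>i\<in>S. F i ^ lookup m i) (\<Prod>i\<in>S. F' i ^ lookup m i)"
    if "finite S" for S
    using that by induction (simp_all add: perturb_one perturb_mult perturb_power F)
  from this [of UNIV] show ?thesis
    by (simp add: monom_subst_def monom_deg_def sum_distrib_left mult.commute)
qed

lemma weight_ge_msubst:
  fixes F :: "('n::finite, 'a::comm_ring_1) pmap"
  assumes F: "\<And>i. weight_ge monom_deg a (F i)" and p: "weight_ge monom_deg k p"
  shows "weight_ge monom_deg (a * k) (msubst p F)"
  unfolding msubst_altdef
proof (rule weight_ge_sum)
  fix m assume "m \<in> keys p"
  then have k: "k \<le> monom_deg m" using p by (simp add: weight_ge_def)
  have "perturb 0 a (F i) (F i)" for i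
    using F by (simp add: perturb_def)
  then have "perturb 0 (a * monom_deg m) (monom_subst m F) (monom_subst m F)"
    by (rule perturb_monom_subst)
  then have "weight_ge monom_deg (0 + a * monom_deg m) (mconst (lookup p m) * monom_subst m F)"
    by (intro weight_ge_mult additive_monom_deg weight_ge_0) (simp add: perturb_def)
  then show "weight_ge monom_deg (a * k) (mconst (lookup p m) * monom_subst m F)"
    using k by (auto elim: weight_ge_antimono)
qed

text \<open>Each \<open>F i\<close> agrees with the variable up to order \<open>c + 1\<close>, so a
  monomial of degree k and its image agree up to order \<open>k + c\<close>; sum over the monomials
  of \<open>p\<close>.\<close>

lemma weight_ge_msubst_diff:
  fixes F H :: "('n::finite, 'a::comm_ring_1) pmap"
  assumes F: "\<And>i. F i = mvar i + H i" and H: "\<And>i. weight_ge monom_deg (Suc c) (H i)"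
    and p: "weight_ge monom_deg k p"
  shows "weight_ge monom_deg (k + c) (msubst p F - p)"
proof -
  have "perturb c 1 (F i) (mvar i)" for i
    using H [of i] by (simp add: F perturb_def) (simp add: weight_ge_def mvar_def)
  then have pert: "perturb c (1 * monom_deg m) (monom_subst m F) (monom_subst m mvar)" for m
    by (rule perturb_monom_subst)
  have "msubst p F - msubst p mvar
      = (\<Sum>m\<in>keys p. mconst (lookup p m) * (monom_subst m F - monom_subst m mvar))"
    unfolding msubst_altdef by (simp add: sum_subtractf right_diff_distrib)
  moreover have "weight_ge monom_deg (k + c) \<dots>"
  proof (rule weight_ge_sum)
    fix m assume "m \<in> keys p"
    then have k: "k \<le> monom_deg m" using p by (simp add: weight_ge_def)
    have "weight_ge monom_deg (0 + (monom_deg m + c))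
        (mconst (lookup p m) * (monom_subst m F - monom_subst m mvar))"
      using pert [of m]
      by (intro weight_ge_mult additive_monom_deg weight_ge_0) (simp add: perturb_def)
    then show "weight_ge monom_deg (k + c)
        (mconst (lookup p m) * (monom_subst m F - monom_subst m mvar))"
      using k by (auto elim: weight_ge_antimono)
  qed
  ultimately show ?thesis by simp
qed

section \<open>The coefficient norm\<close>

text \<open>The l1 norm of the coefficients. Unlike the maximum of their absolute values, it is
  submultiplicative, and it still dominates every single coefficient.\<close>

definition coeff_norm :: "('b \<Rightarrow>\<^sub>0 int) \<Rightarrow> int" where
  "coeff_norm p = (\<Sum>m\<in>keys p. \<bar>lookup p m\<bar>)"

lemma coeff_norm_superset:
  assumes "finite S" "keys p \<subseteq> S"
  shows "coeff_norm p = (\<Sum>m\<in>S. \<bar>lookup p m\<bar>)"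
  unfolding coeff_norm_def using assms
  by (intro sum.mono_neutral_left) (auto simp: in_keys_iff)

lemma coeff_norm_nonneg [simp]: "0 \<le> coeff_norm p"
  by (simp add: coeff_norm_def sum_nonneg)

lemma coeff_norm_zero [simp]: "coeff_norm 0 = 0"
  by (simp add: coeff_norm_def)

lemma coeff_norm_single [simp]: "coeff_norm (single m a) = \<bar>a\<bar>"
  by (subst coeff_norm_superset [of "{m}"]) auto

lemma coeff_norm_uminus [simp]: "coeff_norm (- p) = coeff_norm p"
  by (simp add: coeff_norm_def)

lemma coeff_norm_add: "coeff_norm (p + q) \<le> coeff_norm p + coeff_norm q"
proof -
  have "keys (p + q) \<subseteq> keys p \<union> keys q" by (rule Poly_Mapping.keys_add)
  then show ?thesis
    by (simp add: coeff_norm_superset [of "keys p \<union> keys q"] lookup_add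
        sum.distrib [symmetric] sum_mono)
qed

lemma coeff_norm_diff: "coeff_norm (p - q) \<le> coeff_norm p + coeff_norm q"
  using coeff_norm_add [of p "- q"] by simp

lemma coeff_norm_sum: "coeff_norm (\<Sum>i\<in>S. p i) \<le> (\<Sum>i\<in>S. coeff_norm (p i))"
proof (induction S rule: infinite_finite_induct)
  case (insert i S)
  then show ?case using coeff_norm_add [of "p i" "sum p S"] by simp
qed simp_all

lemma abs_lookup_le_coeff_norm: "\<bar>lookup p m\<bar> \<le> coeff_norm p"
proof (cases "m \<in> keys p")
  case True
  then show ?thesis unfolding coeff_norm_def by (intro member_le_sum) auto
next
  case False
  then show ?thesis by (simp add: in_keys_iff)
qed

lemma coeff_norm_mult:
  fixes p q :: "('n, int) mpoly"
  shows "coeff_norm (p * q) \<le> coeff_norm p * coeff_norm q"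
proof -
  have "p * q = (\<Sum>a\<in>keys p. \<Sum>b\<in>keys q. single (a + b) (lookup p a * lookup q b))"
    by (subst poly_mapping_sum_single [of p], subst poly_mapping_sum_single [of q])
      (simp add: sum_product mult_single)
  then have "coeff_norm (p * q)
      \<le> (\<Sum>a\<in>keys p. coeff_norm (\<Sum>b\<in>keys q. single (a + b) (lookup p a * lookup q b)))"
    by (simp add: coeff_norm_sum)
  also have "\<dots> \<le> (\<Sum>a\<in>keys p. \<Sum>b\<in>keys q. \<bar>lookup p a\<bar> * \<bar>lookup q b\<bar>)"
    by (intro sum_mono order_trans [OF coeff_norm_sum]) (simp add: abs_mult)
  also have "\<dots> = coeff_norm p * coeff_norm q"
    by (simp add: coeff_norm_def sum_product)
  finally show ?thesis .
qed

lemma coeff_norm_monom_subst: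
  fixes F :: "('n::finite, int) pmap"
  assumes F: "\<And>i. coeff_norm (F i) \<le> c"
  shows "coeff_norm (monom_subst m F) \<le> c ^ monom_deg m"
proof -
  have c: "0 \<le> c" using order_trans [OF coeff_norm_nonneg F] .
  have one: "coeff_norm (1 :: ('n, int) mpoly) = 1"
    using coeff_norm_single [of "0 :: 'n \<Rightarrow>\<^sub>0 nat" 1] by simp
  have pow: "coeff_norm (F i ^ k) \<le> c ^ k" for i k
  proof (induction k)
    case (Suc k)
    have "coeff_norm (F i * F i ^ k) \<le> coeff_norm (F i) * coeff_norm (F i ^ k)"
      by (rule coeff_norm_mult)
    also have "\<dots> \<le> c * c ^ k" by (intro mult_mono F Suc.IH c coeff_norm_nonneg)
    finally show ?case by simp
  qed (simp add: one)
  have "coeff_norm (\<Prod>i\<in>S. F i ^ lookup m i) \<le> c ^ (\<Sum>i\<in>S. lookup m i)" if "finite S" for S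
    using that
  proof induction
    case (insert i S)
    have "coeff_norm (F i ^ lookup m i * (\<Prod>i\<in>S. F i ^ lookup m i))
        \<le> coeff_norm (F i ^ lookup m i) * coeff_norm (\<Prod>i\<in>S. F i ^ lookup m i)"
      by (rule coeff_norm_mult)
    also have "\<dots> \<le> c ^ lookup m i * c ^ (\<Sum>i\<in>S. lookup m i)"
      by (intro mult_mono pow insert.IH zero_le_power c coeff_norm_nonneg)
    finally show ?case using insert.hyps by (simp add: power_add)
  qed (simp add: one)
  then show ?thesis by (simp add: monom_subst_def monom_deg_def)
qed

text \<open>By submultiplicativity a monomial of degree j has an image of norm at most
  \<open>c ^ j\<close>, and \<open>1 \<le> c\<close> replaces j by the common bound
  \<open>k\<close>.\<close>

lemma coeff_norm_msubst:
  fixes F :: "('n::finite, int) pmap"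
  assumes F: "\<And>i. coeff_norm (F i) \<le> c" and c: "1 \<le> c" and p: "weight_le monom_deg k p"
  shows "coeff_norm (msubst p F) \<le> c ^ k * coeff_norm p"
proof -
  have "coeff_norm (msubst p F)
      \<le> (\<Sum>m\<in>keys p. coeff_norm (mconst (lookup p m) * monom_subst m F))"
    unfolding msubst_altdef by (rule coeff_norm_sum)
  also have "\<dots> \<le> (\<Sum>m\<in>keys p. \<bar>lookup p m\<bar> * c ^ k)"
  proof (rule sum_mono)
    fix m assume "m \<in> keys p"
    then have k: "monom_deg m \<le> k" using p by (simp add: weight_le_def)
    have "coeff_norm (mconst (lookup p m) * monom_subst m F)
        \<le> coeff_norm (mconst (lookup p m) :: ('n, int) mpoly) * coeff_norm (monom_subst m F)"
      by (rule coeff_norm_mult)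
    also have "\<dots> \<le> \<bar>lookup p m\<bar> * c ^ k"
      using order_trans [OF coeff_norm_monom_subst [OF F] power_increasing [OF k c]]
      by (simp add: mconst_def mult_left_mono)
    finally show "coeff_norm (mconst (lookup p m) * monom_subst m F) \<le> \<bar>lookup p m\<bar> * c ^ k" .
  qed
  also have "\<dots> = c ^ k * coeff_norm p"
    by (simp add: coeff_norm_def sum_distrib_left mult.commute)
  finally show ?thesis .
qed

section \<open>Leading monomials\<close>

text \<open>Strict maximality is required because distinct monomials may share a weight:
  \<open>w\<close> need not induce a monomial order, and a polynomial may have no leading monomial
  for a given \<open>w\<close>.\<close>

definition leading :: "(('n \<Rightarrow>\<^sub>0 nat) \<Rightarrow> nat) \<Rightarrow> ('n, 'a::zero) mpoly \<Rightarrow> ('n \<Rightarrow>\<^sub>0 nat) \<Rightarrow> bool" where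
  "leading w p u \<longleftrightarrow> u \<in> keys p \<and> (\<forall>m\<in>keys p. m \<noteq> u \<longrightarrow> w m < w u)"

lemma leading_single: "a \<noteq> 0 \<Longrightarrow> leading w (single u a) u"
  by (simp add: leading_def)

lemma leading_mult:
  fixes p q :: "('n, 'a::idom) mpoly"
  assumes w: "additive_weight w" and p: "leading w p u" and q: "leading w q v"
  shows "leading w (p * q) (u + v)"
proof -
  define p' where "p' = p - single u (lookup p u)"
  define q' where "q' = q - single v (lookup q v)"
  \<comment> \<open>All of \<open>p * q\<close> except the product of the two leading terms. Its
    monomials have weight below that of \<open>u + v\<close>, so the leading product cannot
    cancel.\<close>
  let ?r = "single u (lookup p u) * q' + p' * q"
  have p': "w m < w u" if "m \<in> keys p'" for m
  proof -
    have "m \<noteq> u" "m \<in> keys p"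
      using that by (auto simp: p'_def in_keys_iff lookup_minus lookup_single when_def split: if_splits)
    then show ?thesis using p by (simp add: leading_def)
  qed
  have q': "w m < w v" if "m \<in> keys q'" for m
  proof -
    have "m \<noteq> v" "m \<in> keys q"
      using that by (auto simp: q'_def in_keys_iff lookup_minus lookup_single when_def split: if_splits)
    then show ?thesis using q by (simp add: leading_def)
  qed
  have q0: "w m \<le> w v" if "m \<in> keys q" for m
    using that q by (cases "m = v") (auto simp: leading_def)
  have r: "w m < w (u + v)" if "m \<in> keys ?r" for m
  proof -
    have "m \<in> keys (single u (lookup p u) * q') \<or> m \<in> keys (p' * q)"
      using subsetD [OF Poly_Mapping.keys_add that] by simp
    then show ?thesis
    proof
      assume "m \<in> keys (single u (lookup p u) * q')"
      from subsetD [OF Poly_Mapping.keys_mult this]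
      obtain a b where "m = a + b" "a \<in> keys (single u (lookup p u))" "b \<in> keys q'"
        by blast
      then show ?thesis
        using q' [of b] by (auto simp: additive_weightD [OF w] split: if_splits)
    next
      assume "m \<in> keys (p' * q)"
      from subsetD [OF Poly_Mapping.keys_mult this]
      obtain a b where "m = a + b" "a \<in> keys p'" "b \<in> keys q"
        by blast
      then show ?thesis
        using p' [of a] q0 [of b] by (auto simp: additive_weightD [OF w])
    qed
  qed
  have "p * q = single u (lookup p u) * single v (lookup q v) + ?r"
    unfolding p'_def q'_def by (simp only: ring_distribs algebra_simps)
  then have "p * q = single (u + v) (lookup p u * lookup q v) + ?r"
    by (simp only: mult_single)
  then have look: "lookup (p * q) m = (lookup p u * lookup q v when u + v = m) + lookup ?r m" for m
    by (simp only: lookup_add lookup_single)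
  have "lookup ?r (u + v) = 0"
    using r [of "u + v"] by (auto simp: in_keys_iff)
  moreover have "lookup p u * lookup q v \<noteq> 0"
    using p q by (simp add: leading_def in_keys_iff)
  ultimately have "u + v \<in> keys (p * q)"
    by (simp add: in_keys_iff look)
  moreover have "w m < w (u + v)" if "m \<in> keys (p * q)" "m \<noteq> u + v" for m
    using that r [of m] by (auto simp: in_keys_iff look)
  ultimately show ?thesis by (simp add: leading_def)
qed

text \<open>Among the monomials of maximal degree choose \<open>u\<close> of maximal Euclidean norm; then by
  Cauchy--Schwarz the functional \<open>m \<mapsto> \<langle>u, m\<rangle>\<close> separates \<open>u\<close> from the other ones.\<close>

lemma ex_leading_of_max_degree:
  fixes p :: "('n::finite, 'a::comm_monoid_add) mpoly"
  assumes "p \<noteq> 0"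
  obtains w u where "additive_weight w" "leading w p u" "weight_le monom_deg (monom_deg u) p"
proof -
  have fin: "finite (keys p)" and ne: "keys p \<noteq> {}"
    using assms poly_mapping_sum_single [of p] by auto
  define e where "e = Max (monom_deg ` keys p)"
  have e_in: "e \<in> monom_deg ` keys p"
    using fin ne by (simp add: e_def)
  have e: "monom_deg m \<le> e" if "m \<in> keys p" for m
    using that fin by (simp add: e_def)
  define T where "T = {m \<in> keys p. monom_deg m = e}"
  have T: "finite T" "T \<noteq> {}" using fin e_in by (auto simp: T_def)
  define sq where "sq m = (\<Sum>i\<in>UNIV. lookup m i ^ 2)" for m :: "'n \<Rightarrow>\<^sub>0 nat"
  have "Max (sq ` T) \<in> sq ` T" using T by simp
  then obtain u where u: "u \<in> T" "sq u = Max (sq ` T)" by auto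
  have umax: "sq m \<le> sq u" if "m \<in> T" for m
    unfolding u(2) using that T by (intro Max_ge) auto
  define ip where "ip m = (\<Sum>i\<in>UNIV. lookup u i * lookup m i)" for m :: "'n \<Rightarrow>\<^sub>0 nat"
  have ip_less: "ip m < ip u" if m: "m \<in> T" "m \<noteq> u" for m
  proof -
    obtain j where j: "lookup m j \<noteq> lookup u j"
      using m(2) poly_mapping_eqI by metis
    \<comment> \<open>The squared distance of \<open>u\<close> and \<open>m\<close>, computed in the
      integers to avoid truncated subtraction; expanding it bounds the inner product.\<close>
    have "0 < (\<Sum>i\<in>UNIV. (int (lookup u i) - int (lookup m i)) ^ 2)"
      by (rule sum_pos2 [of _ j]) (use j in auto)
    also have "\<dots> = int (sq u) + int (sq m) - 2 * int (ip m)"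
      by (simp add: sq_def ip_def power2_diff sum.distrib sum_subtractf sum_distrib_left mult_ac)
    finally have "2 * ip m < sq u + sq m" by linarith
    moreover have "sq m \<le> sq u" by (rule umax [OF m(1)])
    moreover have "ip u = sq u" by (simp add: ip_def sq_def power2_eq_square)
    ultimately show ?thesis by linarith
  qed
  \<comment> \<open>With \<open>C\<close> above all inner products, the degree dominates in
    \<open>w\<close> and \<open>ip\<close> only breaks ties.\<close>
  define C where "C = Suc (Max (ip ` keys p))"
  have C: "ip m < C" if "m \<in> keys p" for m
    using that fin by (simp add: C_def less_Suc_eq_le)
  define w where "w m = C * monom_deg m + ip m" for m
  have w: "additive_weight w"
    unfolding additive_weight_def w_def ip_def
    by (simp add: additive_weightD [OF additive_monom_deg] lookup_add distrib_left sum.distrib)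
  have ue: "monom_deg u = e" "u \<in> keys p" using u(1) by (auto simp: T_def)
  have "w m < w u" if m: "m \<in> keys p" "m \<noteq> u" for m
  proof (cases "m \<in> T")
    case True
    then show ?thesis using ip_less [OF True m(2)] ue by (simp add: w_def T_def)
  next
    case False
    then have "Suc (monom_deg m) \<le> e" using m e [of m] by (simp add: T_def)
    then have "C * Suc (monom_deg m) \<le> C * e" by (rule mult_le_mono2)
    then show ?thesis using C [OF m(1)] ue by (simp add: w_def)
  qed
  then have "leading w p u" using ue by (simp add: leading_def)
  moreover have "weight_le monom_deg (monom_deg u) p"
    using e ue by (simp add: weight_le_def)
  ultimately show ?thesis using w that by blast
qed

lemma leading_power:
  fixes p :: "('n, 'a::idom) mpoly"
  assumes w: "additive_weight w" and p: "leading w p u"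
  shows "leading w (p ^ k) (\<Sum>_<k. u)"
proof (induction k)
  case 0
  show ?case using leading_single [of "1::'a" w 0] by simp
next
  case (Suc k)
  show ?case using leading_mult [OF w p Suc.IH] by (simp add: add.commute)
qed

lemma lookup_mconst_mult: "lookup (mconst c * p) m = (c * lookup p m :: 'a::comm_semiring_1)"
  unfolding mconst_def mult_map_scale_conv_mult [symmetric]
  by (simp add: Poly_Mapping.map.rep_eq when_def)

text \<open>Among the indices with nonzero coefficient take \<open>z\<close> with leading monomial
  of maximal weight. That monomial occurs in no other such \<open>p y\<close>, since it would weigh
  less than \<open>u y\<close>; so its coefficient in the sum cannot vanish.\<close>

lemma leading_independent:
  fixes p :: "'i \<Rightarrow> ('n, 'a::idom) mpoly"
  assumes I: "finite I" and lead: "\<And>x. x \<in> I \<Longrightarrow> leading w (p x) (u x)" and inj: "inj_on u I"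
    and zero: "(\<Sum>x\<in>I. mconst (c x) * p x) = 0" and x: "x \<in> I"
  shows "c x = 0"
proof (rule ccontr)
  assume "c x \<noteq> 0"
  define J where "J = {y \<in> I. c y \<noteq> 0}"
  have J: "finite ((w \<circ> u) ` J)" "(w \<circ> u) ` J \<noteq> {}"
    using I x \<open>c x \<noteq> 0\<close> by (auto simp: J_def)
  obtain z where z: "z \<in> J" "(w \<circ> u) z = Max ((w \<circ> u) ` J)"
    using Max_in [OF J] by force
  have max: "w (u y) \<le> w (u z)" if "y \<in> J" for y
    using Max_ge [OF J(1), of "(w \<circ> u) y"] that z(2) by simp
  have "c y * lookup (p y) (u z) = 0" if y: "y \<in> I" "y \<noteq> z" for y
  proof (rule ccontr)
    assume "c y * lookup (p y) (u z) \<noteq> 0"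
    then have yJ: "y \<in> J" and k: "u z \<in> keys (p y)"
      using y by (auto simp: J_def in_keys_iff)
    have "u z \<noteq> u y" using inj y z(1) by (auto simp: inj_on_def J_def)
    then have "w (u z) < w (u y)" using lead [OF y(1)] k by (simp add: leading_def)
    then show False using max [OF yJ] by simp
  qed
  then have "(\<Sum>y\<in>I. c y * lookup (p y) (u z)) = c z * lookup (p z) (u z)"
    using I z(1) by (subst sum.remove [of I z]) (auto simp: J_def simp del: mult_eq_0_iff)
  moreover have "(\<Sum>y\<in>I. c y * lookup (p y) (u z)) = 0"
    using arg_cong [OF zero, of "\<lambda>q. lookup q (u z)"]
    by (simp add: lookup_sum lookup_mconst_mult)
  ultimately show False
    using z(1) lead [of z] by (simp add: J_def leading_def in_keys_iff)
qed

section \<open>Counting monomials\<close>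

definition monoms_upto :: "nat \<Rightarrow> ('n::finite \<Rightarrow>\<^sub>0 nat) set" where
  "monoms_upto N = {m. monom_deg m \<le> N}"

lemma lookup_le_monom_deg: "lookup m i \<le> monom_deg m"
  unfolding monom_deg_def by (rule member_le_sum) auto

text \<open>All exponents lie in a cube of side \<open>Suc N\<close>. The bound is crude, but only
  polynomial growth in \<open>N\<close> matters.\<close>

lemma monoms_upto_card:
  "finite (monoms_upto N :: ('n::finite \<Rightarrow>\<^sub>0 nat) set) \<and>
   card (monoms_upto N :: ('n \<Rightarrow>\<^sub>0 nat) set) \<le> Suc N ^ CARD('n)"
proof -
  let ?B = "(UNIV :: 'n set) \<rightarrow>\<^sub>E {..N}"
  have sub: "lookup ` monoms_upto N \<subseteq> ?B"
    by (auto simp: monoms_upto_def intro: order_trans [OF lookup_le_monom_deg])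
  have inj: "inj_on lookup (monoms_upto N :: ('n \<Rightarrow>\<^sub>0 nat) set)"
    by (auto simp: inj_on_def intro: poly_mapping_eqI)
  have fin: "finite ?B" by (intro finite_PiE) auto
  have "card (monoms_upto N :: ('n \<Rightarrow>\<^sub>0 nat) set) \<le> card ?B"
    by (rule card_inj_on_le [OF inj sub fin])
  also have "card ?B = Suc N ^ CARD('n)" by (simp add: card_PiE)
  finally show ?thesis using inj_on_finite [OF inj sub fin] by simp
qed

lemma finite_monoms_upto [simp]: "finite (monoms_upto N)"
  using monoms_upto_card by blast

lemma zero_in_monoms_upto [simp]: "0 \<in> monoms_upto N"
  by (simp add: monoms_upto_def monom_deg_def)

text \<open>Division with remainder by \<open>D\<close> in each exponent.\<close>

lemma card_monoms_upto_scale: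
  assumes D: "0 < D"
  shows "card (monoms_upto (D * M) :: ('n::finite \<Rightarrow>\<^sub>0 nat) set)
    \<le> D ^ CARD('n) * card (monoms_upto M :: ('n \<Rightarrow>\<^sub>0 nat) set)"
proof -
  let ?q = "\<lambda>m :: 'n \<Rightarrow>\<^sub>0 nat. Abs_poly_mapping (\<lambda>i. lookup m i div D)"
  let ?f = "\<lambda>m :: 'n \<Rightarrow>\<^sub>0 nat. (\<lambda>i. lookup m i mod D, ?q m)"
  let ?B = "((UNIV :: 'n set) \<rightarrow>\<^sub>E {..<D}) \<times> (monoms_upto M :: ('n \<Rightarrow>\<^sub>0 nat) set)"
  have q: "lookup (?q m) i = lookup m i div D" for m i by simp
  have "inj_on ?f (monoms_upto (D * M))"
  proof (rule inj_onI, rule poly_mapping_eqI)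
    fix a b :: "'n \<Rightarrow>\<^sub>0 nat" and i assume "?f a = ?f b"
    then have "lookup a i mod D = lookup b i mod D" "?q a = ?q b"
      by (auto dest: fun_cong)
    moreover have "lookup a i div D = lookup b i div D"
      using q [of a i] q [of b i] \<open>?q a = ?q b\<close> by simp
    ultimately show "lookup a i = lookup b i"
      by (metis div_mult_mod_eq)
  qed
  moreover have "?f ` monoms_upto (D * M) \<subseteq> ?B"
  proof -
    have "?q m \<in> monoms_upto M" if "m \<in> monoms_upto (D * M)" for m
    proof -
      have "D * monom_deg (?q m) = (\<Sum>i\<in>UNIV. D * (lookup m i div D))"
        by (simp add: monom_deg_def sum_distrib_left)
      also have "\<dots> \<le> monom_deg m"
        unfolding monom_deg_def by (intro sum_mono) simp
      also have "\<dots> \<le> D * M" using that by (simp add: monoms_upto_def)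
      finally show ?thesis using D by (simp add: monoms_upto_def)
    qed
    then show ?thesis using D by auto
  qed
  moreover have "finite ?B" by (auto intro!: finite_PiE)
  ultimately have "card (monoms_upto (D * M) :: ('n \<Rightarrow>\<^sub>0 nat) set) \<le> card ?B"
    by (rule card_inj_on_le)
  then show ?thesis by (simp add: card_cartesian_product card_PiE)
qed

text \<open>Indexes the products \<open>X_i^a F^b\<close> whose degree is guaranteed to be at most
  \<open>N\<close> when the components of \<open>F\<close> have degree at most
  \<open>D\<close>.\<close>

definition weighted_pairs :: "nat \<Rightarrow> nat \<Rightarrow> (nat \<times> ('n::finite \<Rightarrow>\<^sub>0 nat)) set" where
  "weighted_pairs D N = {(a, b). a + D * monom_deg b \<le> N}"

text \<open>Drops the pairs whose \<open>b\<close> is divisible by the monomial \<open>u\<close>, so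
  that \<open>(a, b)\<close> can be recovered from the exponent \<open>a u + b\<close>.\<close>

definition reduced_pairs :: "nat \<Rightarrow> ('n \<Rightarrow>\<^sub>0 nat) \<Rightarrow> nat \<Rightarrow> (nat \<times> ('n::finite \<Rightarrow>\<^sub>0 nat)) set" where
  "reduced_pairs D u N = weighted_pairs D N - {(a, u + c) | a c. True}"

lemma finite_weighted_pairs:
  assumes "0 < D"
  shows "finite (weighted_pairs D N :: (nat \<times> ('n::finite \<Rightarrow>\<^sub>0 nat)) set)"
proof (rule finite_subset)
  show "weighted_pairs D N \<subseteq> {..N} \<times> (monoms_upto N :: ('n \<Rightarrow>\<^sub>0 nat) set)"
  proof (rule subsetI)
    fix x :: "nat \<times> ('n \<Rightarrow>\<^sub>0 nat)" assume "x \<in> weighted_pairs D N"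
    moreover obtain a b where x: "x = (a, b)" by (cases x)
    ultimately have "a + D * monom_deg b \<le> N" by (simp add: weighted_pairs_def)
    moreover have "monom_deg b \<le> D * monom_deg b" using assms by simp
    ultimately have "a \<le> N" "monom_deg b \<le> N" by linarith+
    then show "x \<in> {..N} \<times> monoms_upto N" by (simp add: x monoms_upto_def)
  qed
qed simp

text \<open>Let e be the degree of \<open>u\<close>. The dropped pairs are shifts by
  \<open>u\<close> of the pairs of weight at most \<open>D * M - D * e\<close>, so the remaining
  ones are as many as the pairs with weight in the last \<open>D * e\<close> values. Each
  \<open>b\<close> of degree at most \<open>M - e\<close> admits an \<open>a\<close> for each of
  these values.\<close>

lemma card_reduced_pairs_ge:
  fixes u :: "'n::finite \<Rightarrow>\<^sub>0 nat"
  assumes D: "0 < D" and M: "monom_deg u \<le> M"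
  shows "D * monom_deg u * card (monoms_upto (M - monom_deg u) :: ('n \<Rightarrow>\<^sub>0 nat) set)
    \<le> card (reduced_pairs D u (D * M))"
proof -
  define e where "e = monom_deg u"
  let ?N = "D * M"
  let ?S = "weighted_pairs D :: nat \<Rightarrow> (nat \<times> ('n \<Rightarrow>\<^sub>0 nat)) set"
  let ?g = "\<lambda>(a, c). (a, u + c) :: nat \<times> ('n \<Rightarrow>\<^sub>0 nat)"
  have fin: "finite (?S N)" for N by (rule finite_weighted_pairs [OF D])
  have eN: "D * e \<le> ?N" using M by (simp add: e_def)
  have deg: "monom_deg (u + c) = e + monom_deg c" for c
    by (simp add: e_def additive_weightD [OF additive_monom_deg])
  have sub: "?g ` ?S (?N - D * e) \<subseteq> ?S ?N"
    by (auto simp: weighted_pairs_def deg distrib_left le_diff_conv2 [OF eN])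
  have "reduced_pairs D u ?N = ?S ?N - ?g ` ?S (?N - D * e)"
    by (auto simp: reduced_pairs_def weighted_pairs_def deg distrib_left image_iff
        le_diff_conv2 [OF eN])
  then have "card (reduced_pairs D u ?N) = card (?S ?N) - card (?g ` ?S (?N - D * e))"
    using sub fin by (simp add: card_Diff_subset)
  also have "card (?g ` ?S (?N - D * e)) = card (?S (?N - D * e))"
    by (rule card_image) (auto simp: inj_on_def)
  also have "card (?S ?N) - \<dots> = card (?S ?N - ?S (?N - D * e))"
    using fin by (subst card_Diff_subset) (auto simp: weighted_pairs_def)
  finally have eq: "card (reduced_pairs D u ?N) = card (?S ?N - ?S (?N - D * e))" .
  let ?T = "{..<D * e} \<times> (monoms_upto (M - e) :: ('n \<Rightarrow>\<^sub>0 nat) set)"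
  \<comment> \<open>Here \<open>t\<close> is the defect of the weight from
    \<open>?N\<close>.\<close>
  let ?h = "\<lambda>(t, b). (?N - t - D * monom_deg b, b) :: nat \<times> ('n \<Rightarrow>\<^sub>0 nat)"
  have le: "t + D * monom_deg b < ?N" if "t < D * e" "b \<in> monoms_upto (M - e)" for t b
  proof -
    have "monom_deg b + e \<le> M" using that M by (simp add: monoms_upto_def e_def)
    then have "D * (monom_deg b + e) \<le> ?N" by (rule mult_le_mono2)
    then show ?thesis using that(1) by (simp add: algebra_simps)
  qed
  have "inj_on ?h ?T"
  proof -
    have "t = t'" if "t < D * e" "t' < D * e" "b \<in> monoms_upto (M - e)"
      "?N - t - D * monom_deg b = ?N - t' - D * monom_deg b" for t t' b
      using that le [of t b] le [of t' b] by linarith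
    then show ?thesis by (intro inj_onI) auto
  qed
  moreover have "?h ` ?T \<subseteq> ?S ?N - ?S (?N - D * e)"
  proof (rule image_subsetI)
    fix x assume "x \<in> ?T"
    then obtain t b where x: "x = (t, b)" and t: "t < D * e" and b: "b \<in> monoms_upto (M - e)"
      by auto
    have "t + D * monom_deg b < ?N" by (rule le [OF t b])
    then show "?h x \<in> ?S ?N - ?S (?N - D * e)"
      using t eN by (auto simp: x weighted_pairs_def)
  qed
  ultimately have "card ?T \<le> card (?S ?N - ?S (?N - D * e))"
    using fin by (intro card_inj_on_le) auto
  then show ?thesis using eq by (simp add: card_cartesian_product e_def)
qed

text \<open>If two exponents agree and \<open>a < a'\<close>, cancelling \<open>a\<close> copies of
  \<open>u\<close> shows that \<open>b\<close> is divisible by \<open>u\<close>, which is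
  excluded.\<close>

lemma inj_on_reduced_pairs: "inj_on (\<lambda>(a, b). (\<Sum>_<a. u) + b) (reduced_pairs D u N)"
proof -
  have less: False if a: "a < a'" and eq: "(\<Sum>_<a. u) + b = (\<Sum>_<a'. u) + b'"
    and b: "(a, b) \<in> reduced_pairs D u N" for a a' b b'
  proof -
    obtain k where k: "a' = a + Suc k" using less_imp_Suc_add [OF a] by auto
    have "(\<Sum>_<a + Suc k. u) = (\<Sum>_<a. u) + (u + (\<Sum>_<k. u))"
      by (rule poly_mapping_eqI) (simp add: lookup_add lookup_sum algebra_simps)
    then have "b = u + ((\<Sum>_<k. u) + b')"
      using eq by (simp only: k add.assoc add_left_cancel)
    then show False using b by (auto simp: reduced_pairs_def)
  qed
  have "a = a' \<and> b = b'" if "(\<Sum>_<a. u) + b = (\<Sum>_<a'. u) + b'"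
    "(a, b) \<in> reduced_pairs D u N" "(a', b') \<in> reduced_pairs D u N" for a a' b b'
    using that less [of a a' b b'] less [of a' a b' b]
    by (cases a a' rule: linorder_cases) simp_all
  then show ?thesis by (auto intro!: inj_onI)
qed

section \<open>The degree of the inverse\<close>

text \<open>A homogeneous system with fewer equations than unknowns has a nontrivial solution.
  Elimination by cross multiplication with the pivot keeps everything in the integers.\<close>

lemma ex_int_relation:
  fixes v :: "'i \<Rightarrow> 't \<Rightarrow> int"
  assumes "finite T" "finite I" "card T < card I"
  shows "\<exists>c. (\<exists>i\<in>I. c i \<noteq> 0) \<and> (\<forall>t\<in>T. (\<Sum>i\<in>I. c i * v i t) = 0)"
  using assms
proof (induction T arbitrary: I v rule: finite_induct)
  case empty
  then obtain i where "i \<in> I" by (cases "I = {}") auto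
  then show ?case by (intro exI [of _ "\<lambda>_. 1"]) auto
next
  case (insert t T)
  show ?case
  proof (cases "\<forall>i\<in>I. v i t = 0")
    case True
    have "card T < card I" using insert.hyps insert.prems by simp
    from insert.IH [OF insert.prems(1) this, of v] True show ?thesis by auto
  next
    case False
    then obtain j where j: "j \<in> I" "v j t \<noteq> 0" by blast
    define I' where "I' = I - {j}"
    have I': "finite I'" "card T < card I'"
      using insert.hyps insert.prems j(1) by (simp_all add: I'_def)
    obtain c where c: "\<exists>i\<in>I'. c i \<noteq> 0"
      and rel: "\<And>s. s \<in> T \<Longrightarrow> (\<Sum>i\<in>I'. c i * (v j t * v i s - v i t * v j s)) = 0"
      using insert.IH [OF I', of "\<lambda>i s. v j t * v i s - v i t * v j s"] by auto
    \<comment> \<open>The solution of the reduced system is scaled by the pivot, and the coefficient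
      of \<open>j\<close> is chosen to satisfy equation \<open>t\<close>.\<close>
    define c' where "c' i = (if i = j then - (\<Sum>i\<in>I'. c i * v i t) else v j t * c i)" for i
    have sum: "(\<Sum>i\<in>I. c' i * v i s) = (\<Sum>i\<in>I'. c i * (v j t * v i s - v i t * v j s))" for s
    proof -
      have "(\<Sum>i\<in>I. c' i * v i s) = c' j * v j s + (\<Sum>i\<in>I'. c' i * v i s)"
        using insert.prems(1) j(1) by (simp add: I'_def sum.remove)
      also have "(\<Sum>i\<in>I'. c' i * v i s) = (\<Sum>i\<in>I'. v j t * c i * v i s)"
        by (intro sum.cong) (auto simp: c'_def I'_def)
      finally show ?thesis
        by (simp add: c'_def sum_distrib_left sum_distrib_right right_diff_distrib
            sum_subtractf mult_ac)
    qed
    have "\<exists>i\<in>I. c' i \<noteq> 0" using c j(2) by (auto simp: c'_def I'_def)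
    moreover have "(\<Sum>i\<in>I. c' i * v i s) = 0" if "s \<in> insert t T" for s
    proof (cases "s = t")
      case True
      show ?thesis by (simp add: sum True mult.commute)
    next
      case False
      then show ?thesis using that rel by (simp add: sum)
    qed
    ultimately show ?thesis by blast
  qed
qed

text \<open>If \<open>L < K\<close>, iterating \<open>step\<close> makes \<open>s (k * e)\<close> at
  least \<open>(K / L)^k\<close>, which outgrows the polynomial bound. Bernoulli's inequality makes
  the comparison explicit.\<close>

lemma exponential_beats_polynomial:
  fixes s :: "nat \<Rightarrow> nat"
  assumes step: "\<And>M. e \<le> M \<Longrightarrow> K * s (M - e) \<le> L * s M"
    and pos: "0 < s 0" and poly: "\<And>M. s M \<le> Suc M ^ n"
  shows "K \<le> L"
proof (rule ccontr)
  assume "\<not> K \<le> L"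
  then have KL: "L < K" by simp
  have iter: "K ^ k \<le> L ^ k * s (k * e)" for k
  proof (induction k)
    case 0
    show ?case using pos by simp
  next
    case (Suc k)
    have "K ^ Suc k \<le> L ^ k * (K * s (k * e))" using Suc.IH by (simp add: mult_ac)
    also have "\<dots> \<le> L ^ k * (L * s (Suc k * e))"
      using step [of "Suc k * e"] by (intro mult_le_mono2) simp
    finally show ?case by (simp add: mult_ac)
  qed
  have L: "0 < L" using iter [of 1] KL by (cases L) auto
  define \<delta> where "\<delta> = real K / real L - 1"
  have \<delta>: "0 < \<delta>" using KL L by (simp add: \<delta>_def)
  \<comment> \<open>Chosen so that \<open>1 + j * (n + 1) * e\<close> is at most
    \<open>C * (1 + j * \<delta>)\<close> for every \<open>j\<close>.\<close>
  define C where "C = max 1 (real (Suc n * e) / \<delta>)"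
  \<comment> \<open>The power \<open>n + 1\<close> on the left meets only the power \<open>n\<close>
    on the right; after cancellation a linear function of \<open>j\<close> would be bounded.\<close>
  have bound: "1 + real j * \<delta> \<le> C ^ n" for j
  proof -
    let ?x = "1 + real j * \<delta>"
    have x: "0 < ?x" using \<delta> by (simp add: add_pos_nonneg)
    have "?x \<le> (1 + \<delta>) ^ j" using Bernoulli_inequality [of \<delta> j] \<delta> by simp
    then have "?x ^ Suc n \<le> ((1 + \<delta>) ^ j) ^ Suc n" using x by (intro power_mono) auto
    also have "\<dots> = (real K / real L) ^ (j * Suc n)"
      by (simp only: \<delta>_def power_mult) simp
    also have "\<dots> \<le> real (s (j * Suc n * e))"
    proof -
      have "real (K ^ (j * Suc n)) \<le> real (L ^ (j * Suc n) * s (j * Suc n * e))"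
        using iter [of "j * Suc n"] by (simp only: of_nat_le_iff)
      then show ?thesis using L by (simp add: power_divide divide_simps mult.commute)
    qed
    also have "\<dots> \<le> (1 + real j * real (Suc n * e)) ^ n"
    proof -
      have "real (s (j * Suc n * e)) \<le> real (Suc (j * Suc n * e) ^ n)"
        using poly by (simp only: of_nat_le_iff)
      also have "real (Suc (j * Suc n * e) ^ n) = (1 + real j * real (Suc n * e)) ^ n"
        by (simp add: algebra_simps)
      finally show ?thesis .
    qed
    also have "\<dots> \<le> (C * ?x) ^ n"
    proof (rule power_mono)
      have "real (Suc n * e) \<le> C * \<delta>"
        using \<delta> by (simp add: C_def max_def field_simps)
      then have "real j * real (Suc n * e) \<le> real j * (C * \<delta>)"
        by (rule mult_left_mono) simp
      moreover have "1 \<le> C" by (simp add: C_def)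
      ultimately show "1 + real j * real (Suc n * e) \<le> C * ?x"
        by (simp add: algebra_simps)
    qed simp
    finally have "?x * ?x ^ n \<le> C ^ n * ?x ^ n" by (simp add: power_mult_distrib)
    then show ?thesis using x by (simp add: mult_le_cancel_right)
  qed
  obtain j where "C ^ n < real j * \<delta>"
    using reals_Archimedean3 [OF \<delta>] by blast
  then show False using bound [of j] by simp
qed

text \<open>The polynomials \<open>X\<^sub>i\<^sup>a F\<^sup>b\<close> with \<open>(a, b)\<close> reduced are mapped by \<open>msubst _ G\<close> to
  \<open>G\<^sub>i\<^sup>a X\<^sup>b\<close>, whose leading monomials are distinct; so they are linearly independent.\<close>

lemma card_reduced_pairs_le:
  fixes F G :: "('n::finite, int) pmap"
  assumes inv: "pmap_comp F G = mvar" and F: "\<And>j. weight_le monom_deg D (F j)" and D: "0 < D"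
    and w: "additive_weight w" and lead: "leading w (G i) u"
  shows "card (reduced_pairs D u N) \<le> card (monoms_upto N :: ('n \<Rightarrow>\<^sub>0 nat) set)"
proof (rule ccontr)
  let ?I = "reduced_pairs D u N"
  define v where "v = (\<lambda>(a, b). mvar i ^ a * monom_subst b F)"
  assume "\<not> card ?I \<le> card (monoms_upto N :: ('n \<Rightarrow>\<^sub>0 nat) set)"
  moreover have I: "finite ?I"
    unfolding reduced_pairs_def by (intro finite_Diff finite_weighted_pairs D)
  \<comment> \<open>The products outnumber the monomials available to them, so their coefficient
    vectors satisfy an integer relation.\<close>
  ultimately obtain c where c: "\<exists>x\<in>?I. c x \<noteq> 0"
    and rel: "\<And>m. m \<in> monoms_upto N \<Longrightarrow> (\<Sum>x\<in>?I. c x * lookup (v x) m) = 0"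
    using ex_int_relation [of "monoms_upto N" ?I "\<lambda>x. lookup (v x)"] by auto
  have v: "weight_le monom_deg N (v x)" if "x \<in> ?I" for x
  proof -
    obtain a b where x: "x = (a, b)" by fastforce
    have "weight_le monom_deg 1 (mvar i :: ('n, int) mpoly)" by (simp add: weight_le_def mvar_def)
    from weight_le_power [OF additive_monom_deg this, of a]
    have "weight_le monom_deg (a * 1 + D * monom_deg b) (v x)"
      unfolding x v_def prod.case
      by (intro weight_le_mult weight_le_monom_subst F additive_monom_deg)
    then show ?thesis
      by (rule weight_le_mono) (use that x in \<open>auto simp: reduced_pairs_def weighted_pairs_def\<close>)
  qed
  have "(\<Sum>x\<in>?I. mconst (c x) * v x) = 0"
  proof (rule poly_mapping_eqI)
    fix m
    have "(\<Sum>x\<in>?I. c x * lookup (v x) m) = 0"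
    proof (cases "m \<in> monoms_upto N")
      case False
      then have "lookup (v x) m = 0" if "x \<in> ?I" for x
        using v [OF that] by (auto simp: weight_le_def monoms_upto_def in_keys_iff)
      then show ?thesis by simp
    qed (rule rel)
    then show "lookup (\<Sum>x\<in>?I. mconst (c x) * v x) m = lookup 0 m"
      by (simp add: lookup_sum lookup_mconst_mult)
  qed
  from arg_cong [OF this, of "\<lambda>p. msubst p G"]
  have zero: "(\<Sum>x\<in>?I. mconst (c x) * msubst (v x) G) = 0"
    by (simp add: msubst_sum msubst_mult)
  have FG: "msubst (F j) G = mvar j" for j
    using fun_cong [OF inv, of j] by (simp add: pmap_comp_def)
  have img: "msubst (v (a, b)) G = G i ^ a * single b 1" for a b
    by (simp add: v_def msubst_mult msubst_power monom_subst_def msubst_prod FG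
        monom_subst_mvar [unfolded monom_subst_def])
  have "leading w (msubst (v x) G) ((\<lambda>(a, b). (\<Sum>_<a. u) + b) x)" for x
    using leading_mult [OF w leading_power [OF w lead] leading_single] by (cases x) (simp add: img)
  from leading_independent [OF I this inj_on_reduced_pairs zero] c show False by blast
qed

text \<open>Gabber's bound: the three cardinality estimates chain to the hypothesis
  \<open>step\<close> of \<open>exponential_beats_polynomial\<close>, and one factor
  \<open>D\<close> is cancelled from the outcome.\<close>

lemma degree_inverse_le:
  fixes F G :: "('n::finite, int) pmap"
  assumes inv: "pmap_inverse F G" and F: "\<And>j. weight_le monom_deg D (F j)" and D: "0 < D"
  shows "weight_le monom_deg (D ^ (CARD('n) - 1)) (G i)"
proof (cases "G i = 0")
  case False
  from inv have FG: "pmap_comp F G = mvar" by (simp add: pmap_inverse_def)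
  obtain w u where w: "additive_weight w" "leading w (G i) u"
    and max: "weight_le monom_deg (monom_deg u) (G i)"
    using ex_leading_of_max_degree [OF False] by blast
  let ?s = "\<lambda>M. card (monoms_upto M :: ('n \<Rightarrow>\<^sub>0 nat) set)"
  have "D * monom_deg u \<le> D ^ CARD('n)"
  proof (rule exponential_beats_polynomial)
    fix M assume "monom_deg u \<le> M"
    note card_reduced_pairs_ge [OF D this]
    also note card_reduced_pairs_le [OF FG F D w]
    also note card_monoms_upto_scale [OF D]
    finally show "D * monom_deg u * ?s (M - monom_deg u) \<le> D ^ CARD('n) * ?s M" .
  next
    show "0 < ?s 0" by (auto simp: card_gt_0_iff intro: zero_in_monoms_upto)
  next
    show "?s M \<le> Suc M ^ CARD('n)" for M using monoms_upto_card by blast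
  qed
  also have "D ^ CARD('n) = D * D ^ (CARD('n) - 1)"
    by (subst power_eq_if) simp
  finally have "monom_deg u \<le> D ^ (CARD('n) - 1)" using D by simp
  with max show ?thesis by (rule weight_le_mono)
qed simp

section \<open>Inversion by iterated differences\<close>

definition subst_diff :: "('n::finite, 'a::comm_ring_1) pmap \<Rightarrow> ('n, 'a) mpoly \<Rightarrow> ('n, 'a) mpoly" where
  "subst_diff F p = msubst p F - p"

text \<open>With \<open>\<delta> = \<phi> - 1\<close> for the substitution homomorphism \<open>\<phi>\<close>, this is the finite geometric
  series \<open>(1 + \<delta>) \<Sum>\<^sub>r (-\<delta>)\<^sup>r = 1 - (-\<delta>)\<^sup>m\<close>.\<close>

lemma msubst_alternating_sum:
  "msubst (\<Sum>r<m. (- 1) ^ r * (subst_diff F ^^ r) p) F = p - (- 1) ^ m * (subst_diff F ^^ m) p"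
proof (induction m)
  case (Suc m)
  have "msubst ((subst_diff F ^^ m) p) F = (subst_diff F ^^ Suc m) p + (subst_diff F ^^ m) p"
    by (simp add: subst_diff_def)
  then show ?case
    using Suc.IH
    by (simp add: msubst_add msubst_mult msubst_power msubst_uminus distrib_left)
qed simp

text \<open>Substituting \<open>G\<close> undoes the substitution of \<open>F\<close> in the
  geometric series; the last summand is the truncation error.\<close>

lemma inverse_eq_alternating_sum:
  assumes FG: "pmap_comp F G = mvar"
  shows "msubst p G = (\<Sum>r<m. (- 1) ^ r * (subst_diff F ^^ r) p)
    + (- 1) ^ m * msubst ((subst_diff F ^^ m) p) G"
proof -
  have "msubst (msubst (\<Sum>r<m. (- 1) ^ r * (subst_diff F ^^ r) p) F) G
      = msubst p G - (- 1) ^ m * msubst ((subst_diff F ^^ m) p) G"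
    unfolding msubst_alternating_sum
    by (simp add: msubst_diff msubst_mult msubst_power msubst_uminus)
  then show ?thesis by (simp add: msubst_inverse [OF FG])
qed

text \<open>The variable has order 1 and every difference raises the order by at least
  \<open>c\<close>.\<close>

lemma weight_ge_subst_diff_iter:
  fixes F H :: "('n::finite, 'a::comm_ring_1) pmap"
  assumes F: "\<And>i. F i = mvar i + H i" and H: "\<And>i. weight_ge monom_deg (Suc c) (H i)"
  shows "weight_ge monom_deg (1 + r * c) ((subst_diff F ^^ r) (mvar i))"
proof (induction r)
  case 0
  show ?case by (simp add: weight_ge_def mvar_def)
next
  case (Suc r)
  then show ?case
    using weight_ge_msubst_diff [OF F H Suc.IH] by (simp add: subst_diff_def add_ac)
qed

text \<open>As \<open>F\<close> has no constant terms, the constant term of \<open>G i\<close>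
  survives substitution of \<open>F\<close>, which yields a variable; hence it is zero.\<close>

lemma weight_ge_one_inverse:
  fixes F G :: "('n::finite, 'a::comm_ring_1) pmap"
  assumes GF: "pmap_comp G F = mvar" and F: "\<And>j. weight_ge monom_deg 1 (F j)"
  shows "weight_ge monom_deg 1 (G i)"
proof -
  have pos: "weight_ge monom_deg 1 p \<longleftrightarrow> lookup p 0 = 0" for p :: "('n, 'a) mpoly"
  proof -
    have deg: "monom_deg m = 0 \<longleftrightarrow> m = 0" for m :: "'n \<Rightarrow>\<^sub>0 nat"
      by (auto simp: monom_deg_def intro: poly_mapping_eqI)
    have "weight_ge monom_deg 1 p \<longleftrightarrow> (\<forall>m\<in>keys p. monom_deg m \<noteq> 0)"
      by (simp add: weight_ge_def Suc_le_eq)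
    also have "\<dots> \<longleftrightarrow> lookup p 0 = 0"
      unfolding deg by (auto simp: in_keys_iff)
    finally show ?thesis .
  qed
  define q where "q = G i - mconst (lookup (G i) 0)"
  have "weight_ge monom_deg 1 q"
    unfolding pos by (simp add: q_def lookup_minus mconst_def)
  then have "weight_ge monom_deg (1 * 1) (msubst q F)"
    by (intro weight_ge_msubst F)
  moreover have "mvar i = msubst q F + mconst (lookup (G i) 0)"
    using fun_cong [OF GF, of i] by (simp add: q_def msubst_diff pmap_comp_def)
  ultimately have "lookup (mvar i :: ('n, 'a) mpoly) 0 = lookup (G i) 0"
    unfolding mult_1 pos by (simp add: lookup_add mconst_def)
  moreover have "weight_ge monom_deg 1 (mvar i :: ('n, 'a) mpoly)"
    by (simp add: weight_ge_def mvar_def)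
  ultimately show ?thesis unfolding pos by simp
qed

text \<open>The truncation error has order at least \<open>1 + r * c\<close>, just above the degree
  of \<open>G i\<close>, so the coefficients of \<open>G i\<close> are those of the truncated
  series.\<close>

lemma abs_lookup_inverse_le:
  fixes F G H :: "('n::finite, int) pmap"
  assumes inv: "pmap_inverse F G" and F: "\<And>i. F i = mvar i + H i"
    and H: "\<And>i. weight_ge monom_deg (Suc c) (H i)"
    and G: "weight_le monom_deg (r * c) (G i)"
  shows "\<bar>lookup (G i) m\<bar> \<le> (\<Sum>k<r. coeff_norm ((subst_diff F ^^ k) (mvar i)))"
proof (cases "m \<in> keys (G i)")
  case True
  have FG: "pmap_comp F G = mvar" and GF: "pmap_comp G F = mvar"
    using inv by (auto simp: pmap_inverse_def)
  have F1: "weight_ge monom_deg 1 (F j)" for j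
    unfolding F
    by (intro weight_ge_add weight_ge_antimono [OF H]) (auto simp: weight_ge_def mvar_def)
  let ?R = "msubst ((subst_diff F ^^ r) (mvar i)) G"
  have "weight_ge monom_deg (1 * (1 + r * c)) ?R"
    by (intro weight_ge_msubst weight_ge_one_inverse [OF GF F1] weight_ge_subst_diff_iter [OF F H])
  moreover have "monom_deg m \<le> r * c"
    using G True by (simp add: weight_le_def)
  ultimately have "m \<notin> keys ?R"
    by (auto simp: weight_ge_def)
  then have R: "lookup ((- 1) ^ r * ?R) m = 0"
    by (cases "even r") (simp_all add: in_keys_iff)
  have "G i = (\<Sum>k<r. (- 1) ^ k * (subst_diff F ^^ k) (mvar i)) + (- 1) ^ r * ?R"
    using inverse_eq_alternating_sum [OF FG, of "mvar i"] unfolding msubst_mvar .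
  then have "lookup (G i) m = lookup (\<Sum>k<r. (- 1) ^ k * (subst_diff F ^^ k) (mvar i)) m"
    by (simp only: lookup_add R add_0_right)
  also have "\<bar>\<dots>\<bar> \<le> (\<Sum>k<r. \<bar>lookup ((- 1) ^ k * (subst_diff F ^^ k) (mvar i)) m\<bar>)"
    unfolding lookup_sum by (rule sum_abs)
  also have "\<dots> \<le> (\<Sum>k<r. coeff_norm ((subst_diff F ^^ k) (mvar i)))"
  proof (rule sum_mono)
    fix k
    have "\<bar>lookup ((- 1) ^ k * p) m\<bar> = \<bar>lookup p m\<bar>" for p :: "('n, int) mpoly"
      by (cases "even k") simp_all
    then show "\<bar>lookup ((- 1) ^ k * (subst_diff F ^^ k) (mvar i)) m\<bar>
        \<le> coeff_norm ((subst_diff F ^^ k) (mvar i))"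
      by (simp only: abs_lookup_le_coeff_norm)
  qed
  finally show ?thesis .
next
  case False
  then show ?thesis by (simp add: in_keys_iff sum_nonneg)
qed

text \<open>The first difference is \<open>H i\<close>. The k-th one has degree at most
  \<open>D ^ k\<close>, so the next difference multiplies the norm by at most
  \<open>(l * B) ^ (D ^ k) + 1\<close>.\<close>

lemma coeff_norm_subst_diff_iter:
  fixes F H :: "('n::finite, int) pmap" and B l :: int
  assumes F: "\<And>i. F i = mvar i + H i"
    and deg: "\<And>i. weight_le monom_deg D (F i)" and D: "0 < D"
    and l: "1 \<le> l" and B: "1 \<le> B"
    and F_norm: "\<And>i. coeff_norm (F i) \<le> l * B" and H_norm: "\<And>i. coeff_norm (H i) \<le> (l - 1) * B"
  shows "coeff_norm ((subst_diff F ^^ Suc r) (mvar i))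
    \<le> (l - 1) * B ^ (\<Sum>k<Suc r. D ^ k) * (\<Prod>s=1..r. l ^ (D ^ s) + 1)"
proof (induction r)
  case 0
  show ?case using H_norm [of i] by (simp add: subst_diff_def F)
next
  case (Suc r)
  let ?p = "(subst_diff F ^^ Suc r) (mvar i)"
  let ?b = "(l - 1) * B ^ (\<Sum>k<Suc r. D ^ k) * (\<Prod>s=1..r. l ^ (D ^ s) + 1)"
  have lB: "1 \<le> l * B" using mult_mono [OF l B] l by simp
  have deg_iter: "weight_le monom_deg (D ^ k) ((subst_diff F ^^ k) (mvar i))" for k
  proof (induction k)
    case 0
    show ?case by (simp add: weight_le_def mvar_def)
  next
    case (Suc k)
    have "D ^ k \<le> D * D ^ k" using D by simp
    with Suc.IH have IH: "weight_le monom_deg (D * D ^ k) ((subst_diff F ^^ k) (mvar i))"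
      by (rule weight_le_mono)
    show ?case
      unfolding funpow.simps comp_apply power_Suc subst_diff_def [of F "(subst_diff F ^^ k) _"]
      by (intro weight_le_diff weight_le_msubst [OF additive_monom_deg deg Suc.IH] IH)
  qed
  have "(subst_diff F ^^ Suc (Suc r)) (mvar i) = msubst ?p F - ?p"
    by (simp add: subst_diff_def)
  then have "coeff_norm ((subst_diff F ^^ Suc (Suc r)) (mvar i))
      \<le> coeff_norm (msubst ?p F) + coeff_norm ?p"
    by (simp only: coeff_norm_diff)
  also have "\<dots> \<le> ((l * B) ^ (D ^ Suc r) + 1) * coeff_norm ?p"
    using coeff_norm_msubst [OF F_norm lB deg_iter [of "Suc r"]] by (simp add: distrib_right)
  also have "\<dots> \<le> (B ^ (D ^ Suc r) * (l ^ (D ^ Suc r) + 1)) * ?b"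
  proof (intro mult_mono Suc.IH coeff_norm_nonneg)
    \<comment> \<open>The summand 1 is absorbed by a power of \<open>B\<close>, which is at least
      1.\<close>
    show "(l * B) ^ (D ^ Suc r) + 1 \<le> B ^ (D ^ Suc r) * (l ^ (D ^ Suc r) + 1)"
      using one_le_power [OF B, of "D ^ Suc r"]
      by (simp add: power_mult_distrib distrib_left mult.commute)
    show "0 \<le> B ^ (D ^ Suc r) * (l ^ (D ^ Suc r) + 1)" using l B by simp
  qed
  also have "\<dots> = (l - 1) * B ^ (\<Sum>k<Suc (Suc r). D ^ k) * (\<Prod>s=1..Suc r. l ^ (D ^ s) + 1)"
    by (simp add: power_add mult_ac)
  finally show ?case .
qed

text \<open>All powers of \<open>B\<close> are replaced by the largest one, which is then factored
  out of the sum.\<close>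

lemma sum_coeff_norm_subst_diff_iter:
  fixes F H :: "('n::finite, int) pmap" and B l :: int
  assumes F: "\<And>i. F i = mvar i + H i"
    and deg: "\<And>i. weight_le monom_deg D (F i)" and D: "0 < D"
    and l: "1 \<le> l" and B: "1 \<le> B"
    and F_norm: "\<And>i. coeff_norm (F i) \<le> l * B" and H_norm: "\<And>i. coeff_norm (H i) \<le> (l - 1) * B"
    and mu: "0 < mu"
  shows "(\<Sum>r<mu. coeff_norm ((subst_diff F ^^ r) (mvar i)))
    \<le> B ^ (\<Sum>i=0..mu-2. D ^ i) * (l + (l - 1) * (\<Sum>r=2..mu-1. \<Prod>s=1..r-1. (l ^ (D ^ s) + 1)))"
proof -
  define E where "E = B ^ (\<Sum>i=0..mu-2. D ^ i)"
  define Q where "Q r = (\<Prod>s=1..r. l ^ (D ^ s) + 1)" for r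
  have E: "1 \<le> E" unfolding E_def using B by (rule one_le_power)
  have Q: "0 \<le> Q r" for r unfolding Q_def using l by (intro prod_nonneg) simp
  have X: "coeff_norm (mvar i :: ('n, int) mpoly) = 1" by (simp add: mvar_def)
  show ?thesis
  proof (cases "mu = 1")
    case True
    \<comment> \<open>Truncated subtraction gives \<open>mu - 2 = 0\<close>, so \<open>E\<close>
      equals \<open>B\<close> here and the sum over \<open>r\<close> is empty.\<close>
    have "1 * 1 \<le> E * l" using E l by (intro mult_mono) auto
    then show ?thesis using X by (simp add: True E_def)
  next
    case False
    then have "mu = Suc (Suc (mu - 2))" using mu by simp
    then obtain k where k: "mu = Suc (Suc k)" by blast
    have iter: "coeff_norm ((subst_diff F ^^ Suc r) (mvar i)) \<le> (l - 1) * E * Q r" if "r < Suc k" for r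
    proof -
      have "coeff_norm ((subst_diff F ^^ Suc r) (mvar i))
          \<le> (l - 1) * B ^ (\<Sum>k<Suc r. D ^ k) * Q r"
        unfolding Q_def by (rule coeff_norm_subst_diff_iter [OF F deg D l B F_norm H_norm])
      also have "\<dots> \<le> (l - 1) * E * Q r"
      proof (intro mult_right_mono mult_left_mono Q)
        show "B ^ (\<Sum>k<Suc r. D ^ k) \<le> E"
          unfolding E_def using that k B by (intro power_increasing sum_mono2) auto
      qed (use l in simp)
      finally show ?thesis .
    qed
    have "(\<Sum>r<mu. coeff_norm ((subst_diff F ^^ r) (mvar i)))
        = 1 + (\<Sum>r<Suc k. coeff_norm ((subst_diff F ^^ Suc r) (mvar i)))"
      unfolding k by (subst sum.lessThan_Suc_shift) (simp add: X)
    also have "\<dots> \<le> E + (\<Sum>r<Suc k. (l - 1) * E * Q r)"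
      by (intro add_mono sum_mono iter E) simp
    \<comment> \<open>Since \<open>Q 0 = 1\<close>, the terms for the variable and for the first
      difference combine to \<open>l * E\<close>.\<close>
    also have "\<dots> = E * (l + (l - 1) * (\<Sum>r<k. Q (Suc r)))"
      unfolding sum_distrib_left [symmetric] sum.lessThan_Suc_shift [of Q]
      by (simp add: Q_def [of 0] algebra_simps)
    also have "(\<Sum>r<k. Q (Suc r)) = (\<Sum>r=2..mu-1. \<Prod>s=1..r-1. (l ^ (D ^ s) + 1))"
      unfolding k Q_def
      by (rule sum.reindex_bij_witness [of _ "\<lambda>r. r - 2" "\<lambda>r. r + 2"]) auto
    finally show ?thesis by (simp add: E_def)
  qed
qed

section \<open>Length and coefficient size\<close>

lemma mlength_le_pmap_length: "mlength (F i) \<le> pmap_length F"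
  unfolding pmap_length_def by (rule Max_ge) auto

lemma abs_lookup_le_max_abs_coeff:
  assumes "m \<in> keys (F i)"
  shows "\<bar>lookup (F i) m\<bar> \<le> max_abs_coeff F"
  unfolding max_abs_coeff_def using assms by (intro Max_ge) auto

lemma max_abs_coeff_le:
  fixes G :: "('n::finite, int) pmap"
  assumes "G j \<noteq> 0" and bound: "\<And>i m. \<bar>lookup (G i) m\<bar> \<le> c"
  shows "max_abs_coeff G \<le> c"
proof -
  have "keys (G j) \<noteq> {}" using assms(1) by simp
  then show ?thesis
    unfolding max_abs_coeff_def using bound by (subst Max_le_iff) auto
qed

lemma coeff_norm_le_card_mult:
  assumes "\<And>m. m \<in> keys p \<Longrightarrow> \<bar>lookup p m\<bar> \<le> B"
  shows "coeff_norm p \<le> int (card (keys p)) * B"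
  unfolding coeff_norm_def using assms by (rule sum_bounded_above)

text \<open>A polynomial of order at least 2 has no linear term that could cancel the variable. So
  \<open>F i\<close> has exactly one monomial more than \<open>H i\<close>, which is the source of
  the factor \<open>l - 1\<close>.\<close>

lemma keys_mvar_plus:
  assumes "weight_ge monom_deg 2 (h :: ('n::finite, int) mpoly)"
  shows "keys (mvar i + h) = insert (single i 1) (keys h)" and "single i 1 \<notin> keys h"
proof -
  show h: "single i 1 \<notin> keys h"
    using assms by (auto simp: weight_ge_def)
  show "keys (mvar i + h) = insert (single i 1) (keys h)"
    using h by (auto simp: in_keys_iff mvar_def lookup_add lookup_single when_def split: if_splits)
qed

theorem theorem4p1:
  fixes F G H :: "('n::finite, int) pmap"
    and n d D mu :: nat
    and A B l :: int
  assumes n: "n = CARD('n)"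
    and aut: "polynomial_automorphism F"
    and inv: "pmap_inverse F G"
    and F: "\<And>i. F i = mvar i + H i"
    and H_nonzero: "\<exists>i. H i \<noteq> 0"
    and H_lower: "\<And>i. H i \<noteq> 0 \<Longrightarrow> lower_degree (H i) \<ge> 2"
    and d: "d = Min {lower_degree (H i) | i. H i \<noteq> 0}"
    and D: "D = Max {mdegree (H i) | i. H i \<noteq> 0}"
    and B: "B = max_abs_coeff F"
    and A: "A = max_abs_coeff G"
    and l: "l = int (pmap_length F)"
    and mu: "mu = nat (\<lfloor>(real D ^ (n - 1) - real d) / (real d - 1) + 1\<rfloor> + 1)"
  shows "A \<le> B ^ (\<Sum>i=0..mu-2. D ^ i) * (l - 1) ^ (mu - 2)
               * (\<Prod>j=1..mu-2. (l ^ (D ^ j) + 1) ^ (mu - 1 - j))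
               * (l + (l - 1) * (\<Sum>r=2..mu-1. \<Prod>s=1..r-1. (l ^ (D ^ s) + 1)))"
proof -

  \<comment> \<open>Degree and order bounds for \<open>F\<close> and \<open>H\<close>\<close>
  obtain i0 where i0: "H i0 \<noteq> 0" using H_nonzero by blast
  have lower: "lower_degree p \<le> monom_deg m" and upper: "monom_deg m \<le> mdegree p"
    if "m \<in> keys p" for m and p :: "('n, int) mpoly"
    unfolding lower_degree_def mdegree_def using that by (auto intro: Min_le Max_ge)
  have "d \<in> {lower_degree (H i) | i. H i \<noteq> 0}"
    unfolding d using i0 by (intro Min_in) auto
  then have d2: "2 \<le> d" using H_lower by auto
  have d_le: "d \<le> lower_degree (H i)" if "H i \<noteq> 0" for i
    unfolding d using that by (intro Min_le) auto
  have D_ge: "mdegree (H i) \<le> D" if "H i \<noteq> 0" for i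
    unfolding D using that by (intro Max_ge) auto
  have H_ge: "weight_ge monom_deg d (H i)" for i
    unfolding weight_ge_def
  proof
    fix m assume m: "m \<in> keys (H i)"
    then have "H i \<noteq> 0" by auto
    from order_trans [OF d_le [OF this] lower [OF m]] show "d \<le> monom_deg m" .
  qed
  then have H_ge2: "weight_ge monom_deg 2 (H i)" for i
    using d2 by (rule weight_ge_antimono)
  obtain m0 where m0: "m0 \<in> keys (H i0)" using i0 by fastforce
  have "2 \<le> monom_deg m0" using H_ge2 m0 by (auto simp: weight_ge_def)
  also have "\<dots> \<le> D" using upper [OF m0] D_ge [OF i0] by simp
  finally have D2: "2 \<le> D" .
  have deg: "weight_le monom_deg D (F i)" for i
    unfolding F
  proof (rule weight_le_add)
    show "weight_le monom_deg D (mvar i :: ('n, int) mpoly)"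
      using D2 by (simp add: weight_le_def mvar_def)
    show "weight_le monom_deg D (H i)"
      unfolding weight_le_def
    proof
      fix m assume m: "m \<in> keys (H i)"
      then have "H i \<noteq> 0" by auto
      from order_trans [OF upper [OF m] D_ge [OF this]] show "monom_deg m \<le> D" .
    qed
  qed

  \<comment> \<open>Length and coefficients of \<open>F\<close> and \<open>H\<close>\<close>
  have keysF: "keys (F i) = insert (single i 1) (keys (H i))" "single i 1 \<notin> keys (H i)" for i
    unfolding F using keys_mvar_plus [OF H_ge2] by auto
  have lookF: "lookup (F i) m = lookup (H i) m" if "m \<in> keys (H i)" for i m
    using that keysF(2) [of i] by (auto simp: F mvar_def lookup_add lookup_single when_def)
  have lF: "int (card (keys (F i))) \<le> l" for i
    unfolding l using mlength_le_pmap_length [of F i] by (simp add: mlength_def)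
  have lH: "int (card (keys (H i))) \<le> l - 1" for i
    using lF [of i] keysF [of i] by simp
  have "0 < card (keys (H i0))" using m0 by (auto simp: card_gt_0_iff)
  then have l2: "2 \<le> l" using lH [of i0] by linarith
  have absF: "\<bar>lookup (F i) m\<bar> \<le> B" if "m \<in> keys (F i)" for i m
    unfolding B using that by (rule abs_lookup_le_max_abs_coeff)
  \<comment> \<open>A nonzero integer coefficient has absolute value at least 1.\<close>
  have "single i0 1 \<in> keys (F i0)" by (simp add: keysF)
  from absF [OF this] this have B1: "1 \<le> B" by (simp add: in_keys_iff)
  have F_norm: "coeff_norm (F i) \<le> l * B" for i
  proof -
    have "coeff_norm (F i) \<le> int (card (keys (F i))) * B"
      by (rule coeff_norm_le_card_mult) (rule absF)
    also have "\<dots> \<le> l * B" using lF B1 by (intro mult_right_mono) simp_all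
    finally show ?thesis .
  qed
  have H_norm: "coeff_norm (H i) \<le> (l - 1) * B" for i
  proof -
    have "\<bar>lookup (H i) m\<bar> \<le> B" if m: "m \<in> keys (H i)" for m
      unfolding lookF [OF m, symmetric] by (rule absF) (simp add: keysF m)
    then have "coeff_norm (H i) \<le> int (card (keys (H i))) * B"
      by (rule coeff_norm_le_card_mult)
    also have "\<dots> \<le> (l - 1) * B" using lH B1 by (intro mult_right_mono) simp_all
    finally show ?thesis .
  qed

  \<comment> \<open>Why \<open>mu\<close> terms of the series suffice\<close>
  define x where "x = (real D ^ (n - 1) - real d) / (real d - 1) + 1"
  \<comment> \<open>Rounding down and adding one exceeds \<open>x\<close>, and
    \<open>x * (d - 1) = D^(n-1) - 1\<close>; thus \<open>mu * (d - 1)\<close> reaches the degree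
    bound for the inverse.\<close>
  have "x < real mu" unfolding mu x_def [symmetric] by linarith
  moreover have "x * (real d - 1) = real D ^ (n - 1) - 1"
    using d2 by (simp add: x_def field_simps)
  ultimately have "real D ^ (n - 1) - 1 < real mu * (real d - 1)"
    using d2 mult_strict_right_mono [of x "real mu" "real d - 1"] by simp
  then have "real (D ^ (n - 1)) < real (mu * (d - 1) + 1)"
    using d2 by (simp add: of_nat_diff)
  then have mu_deg: "D ^ (n - 1) \<le> mu * (d - 1)"
    unfolding of_nat_less_iff by simp
  moreover have "0 < D ^ (n - 1)" using D2 by simp
  ultimately have mu0: "0 < mu" by (cases mu) auto

  \<comment> \<open>The coefficient bound for the inverse\<close>
  let ?E = "B ^ (\<Sum>i=0..mu-2. D ^ i)"
  let ?Q = "l + (l - 1) * (\<Sum>r=2..mu-1. \<Prod>s=1..r-1. (l ^ (D ^ s) + 1))"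
  let ?P = "(l - 1) ^ (mu - 2) * (\<Prod>j=1..mu-2. (l ^ (D ^ j) + 1) ^ (mu - 1 - j))"
  have H_Suc: "weight_ge monom_deg (Suc (d - 1)) (H i)" for i
    using H_ge d2 by simp
  have degG: "weight_le monom_deg (mu * (d - 1)) (G i)" for i
    by (rule weight_le_mono [OF degree_inverse_le [OF inv deg]]) (use D2 mu_deg n in simp_all)
  have coeff: "\<bar>lookup (G i) m\<bar> \<le> ?E * ?Q" for i m
  proof -
    have "0 < D" "1 \<le> l" using D2 l2 by simp_all
    from sum_coeff_norm_subst_diff_iter [OF F deg this B1 F_norm H_norm mu0]
    show ?thesis by (rule order_trans [OF abs_lookup_inverse_le [OF inv F H_Suc degG]])
  qed
  \<comment> \<open>Ensures that the maximum defining \<open>A\<close> is taken over a nonempty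
    set.\<close>
  have "G i0 \<noteq> 0"
  proof
    assume "G i0 = 0"
    moreover have "pmap_comp G F i0 = mvar i0"
      using inv by (simp add: pmap_inverse_def)
    ultimately show False by (simp add: pmap_comp_def mvar_def)
  qed
  then have "A \<le> ?E * ?Q"
    unfolding A using coeff by (rule max_abs_coeff_le)
  \<comment> \<open>All factors of \<open>?P\<close> are at least 1 because
    \<open>2 \<le> l\<close>.\<close>
  also have "\<dots> \<le> ?E * ?P * ?Q"
  proof (rule mult_right_mono)
    have "1 * 1 \<le> ?P"
      using l2 by (intro mult_mono one_le_power prod_ge_1) auto
    then show "?E \<le> ?E * ?P"
      using B1 mult_left_mono [of 1 ?P ?E] by simp
    show "0 \<le> ?Q"
      using l2 by (intro add_nonneg_nonneg mult_nonneg_nonneg sum_nonneg prod_nonneg) auto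
  qed
  finally show ?thesis by (simp only: mult.assoc)
qed

end
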